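(* Let $\mathcal P=(P,+,0,1)$ be a semilattice and let $\eta:P\to\mathbb R$ be conditionally negative definite. Define $d_\eta(x,y):=2\eta(x+y)-\eta(x)-\eta(y)$ for $x,y\in P$. Then $(\mathcal P,d_\eta)$ is a pseudo-metric semilattice. Moreover, if $\exp(-\eta)$ is positive definite, then $d_\eta$ is a semilattice metric on $\mathcal P$.
   Context: A semilattice is a set $P$ with a commutative, associative, idempotent binary operation $+$ and elements $0,1$ with $0+x=x$ and $1+x=1$ for all $x\in P$. A function $\eta:P\to\mathbb R$ is conditionally negative definite if $\sum_{i,j}c_ic_j\,\eta(x_i+x_j)\le0$ for all $x_1,\dots,x_n\in P$ and all real $c_1,\dots,c_n$ with $\sum_i c_i=0$. A function $\rho:P\to\mathbb R$ is positive definite if for all distinct $x_1,\dots,x_n\in P$ the matrix $[\rho(x_i+x_j)]_{i,j}$ is positive definite. A pseudo-metric semilattice is a semilattice $(P,+,0,1)$ together with a pseudo-metric $d$ on $P$ such that (1) $d(1,0)=1$; (2) $d(x+z,y+z)\le d(x,y)$; and (3) $d(x,y)\le d(x+y,0)+d(x+z,x)+d(y+z,y)-d(z,0)$, for all $x,y,z\in P$. A semilattice metric is a metric $d$ on $P$ with these properties, i.e. one making $(P,+,0,1,d)$ a metric semilattice.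
   Formalization: The condition η(1)−η(0)=1 is added for the conclusions that include d_η(1,0)=1, since d_η(1,0)=η(1)−η(0) and the claim fails for η=0; the pseudo-metric property, (2), (3) and, if exp(−η) is positive definite, the metric property are proved without it. *)

theory Defs
  imports "HOL-Analysis.Abstract_Metric_Spaces"
begin

locale semilattice_01 = semilattice_neutr add zero
  for add :: "'a \<Rightarrow> 'a \<Rightarrow> 'a" (infixl \<open>\<oplus>\<close> 65) and zero :: 'a (\<open>\<zero>\<close>) +
  fixes one :: 'a (\<open>\<one>\<close>)
  assumes one_absorbs: "\<one> \<oplus> x = \<one>"

definition cond_negative_definite :: "('a \<Rightarrow> 'a \<Rightarrow> 'a) \<Rightarrow> ('a \<Rightarrow> real) \<Rightarrow> bool" where
  "cond_negative_definite add \<eta> \<longleftrightarrow>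
     (\<forall>(n::nat) (x::nat \<Rightarrow> 'a) (c::nat \<Rightarrow> real). (\<Sum>i<n. c i) = 0 \<longrightarrow>
        (\<Sum>i<n. \<Sum>j<n. c i * c j * \<eta> (add (x i) (x j))) \<le> 0)"

(* Symmetry of the matrices is automatic when add is commutative. *)
definition positive_definite :: "('a \<Rightarrow> 'a \<Rightarrow> 'a) \<Rightarrow> ('a \<Rightarrow> real) \<Rightarrow> bool" where
  "positive_definite add \<rho> \<longleftrightarrow>
     (\<forall>(n::nat) (x::nat \<Rightarrow> 'a). inj_on x {..<n} \<longrightarrow>
        (\<forall>c::nat \<Rightarrow> real. (\<exists>i<n. c i \<noteq> 0) \<longrightarrow>
           (\<Sum>i<n. \<Sum>j<n. c i * c j * \<rho> (add (x i) (x j))) > 0))"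

locale pseudo_metric =
  fixes d :: "'a \<Rightarrow> 'a \<Rightarrow> real"
  assumes nonneg: "0 \<le> d x y"
    and refl: "d x x = 0"
    and commute: "d x y = d y x"
    and triangle: "d x z \<le> d x y + d y z"

text \<open>All axioms of a pseudo-metric semilattice except the normalization \<open>d \<one> \<zero> = 1\<close>.\<close>
locale unnormalized_pseudo_metric_semilattice = semilattice_01 add zero one + pseudo_metric d
  for add :: "'a \<Rightarrow> 'a \<Rightarrow> 'a" (infixl \<open>\<oplus>\<close> 65) and zero :: 'a (\<open>\<zero>\<close>) and one :: 'a (\<open>\<one>\<close>)
    and d :: "'a \<Rightarrow> 'a \<Rightarrow> real" +
  assumes contraction: "d (x \<oplus> z) (y \<oplus> z) \<le> d x y"
    and join_bound: "d x y \<le> d (x \<oplus> y) \<zero> + d (x \<oplus> z) x + d (y \<oplus> z) y - d z \<zero>"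

locale pseudo_metric_semilattice = unnormalized_pseudo_metric_semilattice add zero one d
  for add :: "'a \<Rightarrow> 'a \<Rightarrow> 'a" (infixl \<open>\<oplus>\<close> 65) and zero :: 'a (\<open>\<zero>\<close>) and one :: 'a (\<open>\<one>\<close>)
    and d :: "'a \<Rightarrow> 'a \<Rightarrow> real" +
  assumes normalized: "d \<one> \<zero> = 1"

locale metric_semilattice = pseudo_metric_semilattice add zero one d + Metric_space UNIV d
  for add :: "'a \<Rightarrow> 'a \<Rightarrow> 'a" and zero :: 'a and one :: 'a and d :: "'a \<Rightarrow> 'a \<Rightarrow> real"

definition d_eta :: "('a \<Rightarrow> 'a \<Rightarrow> 'a) \<Rightarrow> ('a \<Rightarrow> real) \<Rightarrow> 'a \<Rightarrow> 'a \<Rightarrow> real" where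
  "d_eta add \<eta> x y = 2 * \<eta> (add x y) - \<eta> x - \<eta> y"

text \<open>The axiom \<open>d \<one> \<zero> = 1\<close> for \<open>d_eta\<close> is a condition on the scale of \<open>\<eta>\<close>. It does not
  follow from conditional negative definiteness, which is preserved by positive multiples.\<close>
lemma (in semilattice_01) d_eta_one_zero: "d_eta add \<eta> \<one> \<zero> = \<eta> \<one> - \<eta> \<zero>"
  by (simp add: d_eta_def one_absorbs)

end

theory Submission
  imports Defs
begin

text \<open>
  Testing conditional negative definiteness on two small families of points shows that \<open>\<eta>\<close> is
  monotone, \<open>\<eta> a \<le> \<eta> (a \<oplus> b)\<close>, and submodular, \<open>\<eta> (a \<oplus> b \<oplus> c) + \<eta> a \<le> \<eta> (a \<oplus> b) + \<eta> (a \<oplus> c)\<close>.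
  The weights are those of the finite differences of order one and two: \<open>1, -1\<close> at \<open>a, a \<oplus> b\<close>,
  and \<open>1, -1, -1, 1\<close> at \<open>a, a \<oplus> b, a \<oplus> c, a \<oplus> b \<oplus> c\<close>. By idempotence each quadratic form collapses
  to the finite difference of \<open>\<eta>\<close> itself.

  The metric axioms depend only on these two properties. Write \<open>d x y = (\<eta> (x \<oplus> y) - \<eta> x) +
  (\<eta> (x \<oplus> y) - \<eta> y)\<close>. Monotonicity makes both increments nonnegative, and submodularity says that
  the increment \<open>\<eta> (a \<oplus> z) - \<eta> a\<close> shrinks when \<open>a\<close> grows, which yields contraction. The triangle
  inequality and the join bound both reduce to
  \<open>\<eta> (x \<oplus> y) + \<eta> z \<le> \<eta> (x \<oplus> z) + \<eta> (y \<oplus> z)\<close>, which follows by passing through \<open>\<eta> (x \<oplus> y \<oplus> z)\<close>.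

  Finally, \<open>d x y = 0\<close> forces \<open>\<eta> x = \<eta> y = \<eta> (x \<oplus> y)\<close>, so that the two-by-two matrix of
  \<open>exp (- \<eta>)\<close> at \<open>x, y\<close> has all entries equal. If \<open>x \<noteq> y\<close> it would have to be positive definite,
  yet it is singular.
\<close>

context semilattice_01
begin

lemma cond_negative_definite_mono:
  assumes "cond_negative_definite add \<eta>"
  shows "\<eta> a \<le> \<eta> (a \<oplus> b)"
proof -
  let ?x = "(!) [a, a \<oplus> b]" and ?c = "(!) [1, -1 :: real]"
  have "(\<Sum>i<2. ?c i) = 0"
    by (simp add: eval_nat_numeral)
  then have "(\<Sum>i<2. \<Sum>j<2. ?c i * ?c j * \<eta> (?x i \<oplus> ?x j)) \<le> 0"
    using assms unfolding cond_negative_definite_def by blast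
  then show ?thesis
    by (simp add: eval_nat_numeral ac_simps)
qed

text \<open>
  With weights \<open>1, -1, -1, 1\<close> at \<open>a, a \<oplus> b, a \<oplus> c, a \<oplus> b \<oplus> c\<close>, every row of the form except that
  of \<open>a\<close> sums to zero: joining with \<open>b\<close> identifies \<open>a\<close> with \<open>a \<oplus> b\<close> and \<open>a \<oplus> c\<close> with
  \<open>a \<oplus> b \<oplus> c\<close>, whose weights cancel, and likewise for \<open>c\<close>. The row of \<open>a\<close> is the second
  difference of \<open>\<eta>\<close>.
\<close>
lemma cond_negative_definite_submodular:
  assumes "cond_negative_definite add \<eta>"
  shows "\<eta> (a \<oplus> b \<oplus> c) + \<eta> a \<le> \<eta> (a \<oplus> b) + \<eta> (a \<oplus> c)"
proof -
  let ?x = "(!) [a, a \<oplus> b, a \<oplus> c, a \<oplus> b \<oplus> c]" and ?c = "(!) [1, -1, -1, 1 :: real]"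
  have "(\<Sum>i<4. ?c i) = 0"
    by (simp add: eval_nat_numeral)
  then have "(\<Sum>i<4. \<Sum>j<4. ?c i * ?c j * \<eta> (?x i \<oplus> ?x j)) \<le> 0"
    using assms unfolding cond_negative_definite_def by blast
  then show ?thesis
    by (simp add: eval_nat_numeral ac_simps)
qed

lemma d_eta_pseudo_metric_semilattice:
  assumes mono: "\<And>a b. \<eta> a \<le> \<eta> (a \<oplus> b)"
    and submodular: "\<And>a b c. \<eta> (a \<oplus> b \<oplus> c) + \<eta> a \<le> \<eta> (a \<oplus> b) + \<eta> (a \<oplus> c)"
  shows "unnormalized_pseudo_metric_semilattice add \<zero> \<one> (d_eta add \<eta>)"
proof -
  have through: "\<eta> (x \<oplus> y) + \<eta> z \<le> \<eta> (x \<oplus> z) + \<eta> (y \<oplus> z)" for x y z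
    using mono[of "x \<oplus> y" z] submodular[of z x y] by (simp add: ac_simps)
  show ?thesis
  proof unfold_locales
    fix x y z
    show "0 \<le> d_eta add \<eta> x y"
      using mono[of x y] mono[of y x] by (simp add: d_eta_def ac_simps)
    show "d_eta add \<eta> x x = 0"
      by (simp add: d_eta_def)
    show "d_eta add \<eta> x y = d_eta add \<eta> y x"
      by (simp add: d_eta_def ac_simps)
    show "d_eta add \<eta> x z \<le> d_eta add \<eta> x y + d_eta add \<eta> y z"
      using through[of x z y] by (simp add: d_eta_def ac_simps)
    show "d_eta add \<eta> (x \<oplus> z) (y \<oplus> z) \<le> d_eta add \<eta> x y"
      using submodular[of x y z] submodular[of y x z] by (simp add: d_eta_def ac_simps)
    show "d_eta add \<eta> x y \<le> d_eta add \<eta> (x \<oplus> y) \<zero> + d_eta add \<eta> (x \<oplus> z) x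
        + d_eta add \<eta> (y \<oplus> z) y - d_eta add \<eta> z \<zero>"
      using through[of x y z] by (simp add: d_eta_def ac_simps)
  qed
qed

lemma d_eta_eq_0_imp_eq:
  assumes mono: "\<And>a b. \<eta> a \<le> \<eta> (a \<oplus> b)"
    and pos: "positive_definite add (\<lambda>x. exp (- \<eta> x))"
    and zero: "d_eta add \<eta> x y = 0"
  shows "x = y"
proof (rule ccontr)
  assume "x \<noteq> y"
  have eq: "\<eta> x = \<eta> (x \<oplus> y)" "\<eta> y = \<eta> (x \<oplus> y)"
    using mono[of x y] mono[of y x] zero by (simp_all add: d_eta_def ac_simps)
  let ?x = "(!) [x, y]" and ?c = "(!) [1, -1 :: real]"
  have "inj_on ?x {..<2}"
    using \<open>x \<noteq> y\<close> by (auto simp: inj_on_def less_2_cases_iff)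
  moreover have "\<exists>i<2. ?c i \<noteq> 0"
    by (rule exI[of _ 0]) simp
  ultimately have "(\<Sum>i<2. \<Sum>j<2. ?c i * ?c j * exp (- \<eta> (?x i \<oplus> ?x j))) > 0"
    using pos unfolding positive_definite_def by blast
  then show False
    by (simp add: eval_nat_numeral eq commute[of y x])
qed

end

theorem proposition4p17:
  fixes add :: "'a \<Rightarrow> 'a \<Rightarrow> 'a" and zero one :: 'a and \<eta> :: "'a \<Rightarrow> real"
  assumes "semilattice_01 add zero one"
    and "cond_negative_definite add \<eta>"
  shows "unnormalized_pseudo_metric_semilattice add zero one (d_eta add \<eta>)
    \<and> (\<eta> one - \<eta> zero = 1 \<longrightarrow> pseudo_metric_semilattice add zero one (d_eta add \<eta>))
    \<and> (positive_definite add (\<lambda>x. exp (- \<eta> x)) \<longrightarrow>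
         Metric_space UNIV (d_eta add \<eta>)
         \<and> (\<eta> one - \<eta> zero = 1 \<longrightarrow> metric_semilattice add zero one (d_eta add \<eta>)))"
proof -
  interpret semilattice_01 add zero one by fact
  note mono = cond_negative_definite_mono[OF assms(2)]
  have pm: "unnormalized_pseudo_metric_semilattice add zero one (d_eta add \<eta>)"
    using mono cond_negative_definite_submodular[OF assms(2)]
    by (rule d_eta_pseudo_metric_semilattice)
  then interpret D: unnormalized_pseudo_metric_semilattice add zero one "d_eta add \<eta>" .
  have norm: "pseudo_metric_semilattice add zero one (d_eta add \<eta>)" if "\<eta> one - \<eta> zero = 1"
    by unfold_locales (simp add: d_eta_one_zero that)
  have metric: "Metric_space UNIV (d_eta add \<eta>)"
    if "positive_definite add (\<lambda>x. exp (- \<eta> x))"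
    using d_eta_eq_0_imp_eq[OF mono that]
    by unfold_locales (auto simp: D.nonneg D.refl D.triangle intro: D.commute)
  show ?thesis
    using pm norm metric by (simp add: metric_semilattice_def)
qed

end
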